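(* Let $\mathbb{F}$ be a field, let $(\mathcal{V}, \langle \cdot , \cdot \rangle)$ be a pre-euclidean space over $\mathbb{F}$ with basis $\mathcal{B}=\{e_i\}_{i\in I}$, and let $f:\mathcal{V}\to\mathcal{V}$ be a linear operator. If $\mathcal{V}$ is minimal (with respect to $f$ and $\mathcal{B}$), then the graph $\Gamma(f,\mathcal{B})$ associated to $f$ relative to $\mathcal{B}$ is weakly symmetric.
   Context: Vector spaces are over an arbitrary field $\mathbb{F}$ and of arbitrary (possibly infinite) dimension. A pre-euclidean space is a pair $(\mathcal{V}, \langle\cdot,\cdot\rangle)$ where $\mathcal{V}$ is an $\mathbb{F}$-vector space and $\langle\cdot,\cdot\rangle:\mathcal{V}\times\mathcal{V}\to\mathbb{F}$ is a bilinear form (no symmetry or non-degeneracy is assumed). A pre-euclidean subspace is a linear subspace with the restricted form. Associated graph: $\Gamma(f,\mathcal{B})=(V,E)$ is the directed graph with vertex set $V=\mathcal{B}$ and with $(e_i,e_j)\in E$ if and only if $\langle e_i,e_j\rangle\neq 0$, or $\langle e_j,e_i\rangle\neq 0$, or the coefficient of $e_j$ in the expansion of $f(e_i)$ in the basis $\mathcal{B}$ is non-zero (loops are allowed). A directed path from $v$ to $w$ in a graph $(V,E)$ is a finite sequence of vertices $(v_1,\dots,v_n)$ with $v_1=v$, $v_n=w$ and $(v_r,v_{r+1})\in E$ for $1\le r\le n-1$. A graph $(V,E)$ is weakly symmetric if for any $(v,w)\in E$ there exists a directed path from $w$ to $v$. A linear subspace $U$ of $\mathcal{V}$ admits a basis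 inherited from $\mathcal{B}$ if some subset of $\mathcal{B}$ is a basis of $U$. $\mathcal{V}$ is minimal (with respect to $f$ and $\mathcal{B}$) if the only pre-euclidean subspaces $U$ of $\mathcal{V}$ admitting a basis inherited from $\mathcal{B}$ and satisfying $f(U)\subset U$ are $\{0\}$ and $\mathcal{V}$. *)

theory Defs
  imports Complex_Main "Graph_Theory.Graph_Theory"
begin

text \<open>The ambient vector space is the whole type, with an arbitrary scalar multiplication by an
  arbitrary field; its dimension is unrestricted.\<close>

locale pre_euclidean_space = vector_space scale
  for scale :: "'k::field \<Rightarrow> 'v::ab_group_add \<Rightarrow> 'v" (infixr "*s" 75) +
  fixes form :: "'v \<Rightarrow> 'v \<Rightarrow> 'k"
  assumes linear_form_right: "\<And>x. Vector_Spaces.linear scale (*) (\<lambda>y. form x y)"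
    and linear_form_left: "\<And>y. Vector_Spaces.linear scale (*) (\<lambda>x. form x y)"

definition (in vector_space) is_basis_of :: "'b set \<Rightarrow> 'b set \<Rightarrow> bool" where
  "is_basis_of B U \<longleftrightarrow> independent B \<and> span B = U"

definition (in vector_space) admits_inherited_basis :: "'b set \<Rightarrow> 'b set \<Rightarrow> bool" where
  "admits_inherited_basis B U \<longleftrightarrow> (\<exists>B'\<subseteq>B. is_basis_of B' U)"

context pre_euclidean_space
begin

text \<open>A pre-euclidean subspace is a linear subspace together with the restriction of the form,
  so it is determined by the linear subspace.\<close>

definition minimal :: "('v \<Rightarrow> 'v) \<Rightarrow> 'v set \<Rightarrow> bool" where
  "minimal f B \<longleftrightarrow>
    (\<forall>U. subspace U \<and> admits_inherited_basis B U \<and> f ` U \<subseteq> U \<longrightarrow> U = {0} \<or> U = UNIV)"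

definition associated_graph :: "('v \<Rightarrow> 'v) \<Rightarrow> 'v set \<Rightarrow> 'v pair_pre_digraph" where
  "associated_graph f B =
    \<lparr> pverts = B,
      parcs = {(u, v). u \<in> B \<and> v \<in> B \<and>
        (form u v \<noteq> 0 \<or> form v u \<noteq> 0 \<or> representation B (f u) v \<noteq> 0)} \<rparr>"

end

text \<open>Directed paths may repeat vertices and may consist of a single vertex;
  this is the library's \<^const>\<open>vwalk\<close>, not its \<^const>\<open>vpath\<close>.\<close>

definition directed_path :: "'a pair_pre_digraph \<Rightarrow> 'a \<Rightarrow> 'a list \<Rightarrow> 'a \<Rightarrow> bool" where
  "directed_path G v p w \<longleftrightarrow> vwalk p (with_proj G) \<and> hd p = v \<and> last p = w"

definition weakly_symmetric :: "'a pair_pre_digraph \<Rightarrow> bool" where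
  "weakly_symmetric G \<longleftrightarrow> (\<forall>(v, w) \<in> parcs G. \<exists>p. directed_path G w p v)"

end

theory Submission
  imports Defs
begin

text \<open>The vertices reachable from \<open>w\<close> span an \<open>f\<close>-invariant subspace with inherited basis,
  because \<open>f e\<close> only involves out-neighbours of \<open>e\<close>. It contains \<open>w \<noteq> 0\<close>, so by minimality it is
  everything, and linear independence then forces every basis vector to be reachable from \<open>w\<close>.\<close>

theorem theorem5p1:
  fixes scale :: "'k::field \<Rightarrow> 'v::ab_group_add \<Rightarrow> 'v"
    and form :: "'v \<Rightarrow> 'v \<Rightarrow> 'k"
    and B :: "'v set"
    and f :: "'v \<Rightarrow> 'v"
  assumes "pre_euclidean_space scale form"
    and "vector_space.is_basis_of scale B UNIV"
    and "Vector_Spaces.linear scale scale f"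
    and "pre_euclidean_space.minimal scale f B"
  shows "weakly_symmetric (pre_euclidean_space.associated_graph scale form f B)"
proof -
  interpret pre_euclidean_space scale form by fact
  interpret f: Vector_Spaces.linear scale scale f by fact
  have ind: "independent B" and spn: "span B = UNIV"
    using assms(2) by (auto simp: is_basis_of_def)
  let ?G = "associated_graph f B"
  interpret G: pair_wf_digraph ?G
    by unfold_locales (auto simp: associated_graph_def)
  have verts: "pverts ?G = B" by (simp add: associated_graph_def)
  \<comment> \<open>This is strong connectivity of the graph; weak symmetry is the special case
    where \<open>(v, w)\<close> is an arc.\<close>
  have reach: "w \<rightarrow>\<^sup>*\<^bsub>?G\<^esub> v" if vw: "v \<in> B" "w \<in> B" for v w
  proof -
    define R where "R = {u. w \<rightarrow>\<^sup>*\<^bsub>?G\<^esub> u}"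
    have RB: "R \<subseteq> B"
      unfolding R_def by (auto dest: G.reachable_in_verts(2) simp: verts)
    \<comment> \<open>Reachability is reflexive only at vertices, so \<open>w \<in> B\<close>
      matters here.\<close>
    have wR: "w \<in> R"
      using vw by (simp add: R_def verts)
    have "f b \<in> span R" if "b \<in> R" for b
    proof -
      have "c \<in> R" if "representation B (f b) c \<noteq> 0" for c
      proof -
        have "c \<in> B" using that by (rule representation_ne_zero)
        then have "(b, c) \<in> parcs ?G"
          using that \<open>b \<in> R\<close> RB by (auto simp: associated_graph_def)
        then have "b \<rightarrow>\<^bsub>?G\<^esub> c" by simp
        with \<open>b \<in> R\<close> show ?thesis
          unfolding R_def by (simp add: G.reachable_adj_trans)
      qed
      \<comment> \<open>The sum is the expansion of \<open>f b\<close> in \<open>B\<close>,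
        restricted to its support, which lies in \<open>R\<close>.\<close>
      then have "(\<Sum>c | representation B (f b) c \<noteq> 0. scale (representation B (f b) c) c) \<in> span R"
        by (intro span_sum span_scale span_base) simp
      then show ?thesis
        using ind spn by (simp add: sum_nonzero_representation_eq)
    qed
    \<comment> \<open>By linearity \<open>f\<close> span R\<open>equals\<close>span (f
      \<open>R)\<close>, so invariance need only be checked on the generators in
      \<open>R\<close>.\<close>
    then have "f ` span R \<subseteq> span R"
      unfolding f.span_image[symmetric] by (intro span_minimal image_subsetI subspace_span)
    moreover have "admits_inherited_basis B (span R)"
      unfolding admits_inherited_basis_def is_basis_of_def using RB independent_mono[OF ind RB] by blast
    moreover have "span R \<noteq> {0}"
    proof -
      have "w \<noteq> 0" using ind \<open>w \<in> B\<close> dependent_zero by metis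
      then show ?thesis using span_base[OF wR] by blast
    qed
    ultimately have "span R = UNIV"
      using assms(4) subspace_span[of R] unfolding minimal_def by metis
    have "v \<in> R"
    proof (rule ccontr)
      assume "v \<notin> R"
      \<comment> \<open>Since \<open>span R\<close> is everything, this inclusion would put
        \<open>v\<close> in the span of the other basis vectors.\<close>
      then have "span R \<subseteq> span (B - {v})"
        using RB by (intro span_mono) auto
      with \<open>span R = UNIV\<close> \<open>v \<in> B\<close> ind show False
        by (auto simp: dependent_def)
    qed
    then show ?thesis by (simp add: R_def)
  qed
  \<comment> \<open>Existence of a directed path is rewritten as reachability, and both ends of an
    arc lie in \<open>B\<close>.\<close>
  show ?thesis
    unfolding weakly_symmetric_def directed_path_def G.reachable_vwalk_conv[symmetric]
    using reach G.in_arcsD1 G.in_arcsD2 unfolding verts by blast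
qed

end
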